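(* There is a Borel reduction of $E_0$ to $\mathrel{E_{\mathbb{Z}}}$ (restricted to almost periodic functions) whose image is contained in a single $\mathrel{E_{\mathrm{fin}}}$-class. In particular, there is an $\mathrel{E_{\mathrm{fin}}}$-class containing continuum many pairwise non-$\mathrel{E_{\mathbb{Z}}}$-equivalent almost periodic functions.
   Context: $E_0$ is the equivalence relation on $2^\omega$ of eventual equality. Functions $\mathbb{Z}\to\mathbb{N}\cup\{\infty\}$ form the Polish space $(\mathbb{N}\cup\{\infty\})^{\mathbb{Z}}$ with the product of discrete topologies. A function $f\colon\mathbb{Z}\to\mathbb{N}\cup\{\infty\}$ is almost periodic if it is not periodic but for every $n\in\mathbb{N}$ the function $\min(n,f)$ is periodic. $f\mathrel{E_{\mathbb{Z}}}g$ means there is $n\in\mathbb{Z}$ with $f(m)=g(m+n)$ for all $m$; $f\mathrel{E_{\mathrm{fin}}}g$ means $\min(\ell,f)\mathrel{E_{\mathbb{Z}}}\min(\ell,g)$ for every $\ell\in\mathbb{N}$. A Borel reduction of $E$ to $F$ is a Borel map $\phi$ with $x\mathrel{E}y\iff\phi(x)\mathrel{F}\phi(y)$. *)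

theory Defs
  imports "HOL-Analysis.Analysis" "HOL-Library.Extended_Nat" "HOL-Library.Equipollence"
begin

definition borel_of :: "'a topology \<Rightarrow> 'a measure" where
  "borel_of X = sigma (topspace X) {U. openin X U}"

definition borel_reduction ::
  "'a topology \<Rightarrow> ('a \<times> 'a) set \<Rightarrow> 'b topology \<Rightarrow> ('b \<times> 'b) set \<Rightarrow> ('a \<Rightarrow> 'b) \<Rightarrow> bool" where
  "borel_reduction X E Y F \<phi> \<longleftrightarrow>
     \<phi> \<in> borel_of X \<rightarrow>\<^sub>M borel_of Y \<and>
     (\<forall>x\<in>topspace X. \<forall>y\<in>topspace X. (x, y) \<in> E \<longleftrightarrow> (\<phi> x, \<phi> y) \<in> F)"

definition cantor_space :: "(nat \<Rightarrow> bool) topology" where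
  "cantor_space = product_topology (\<lambda>_. discrete_topology UNIV) UNIV"

definition E0 :: "((nat \<Rightarrow> bool) \<times> (nat \<Rightarrow> bool)) set" where
  "E0 = {(x, y). \<exists>N. \<forall>n\<ge>N. x n = y n}"

text \<open>The discrete topology on the factors is given explicitly: the type class topology of
  \<^typ>\<open>enat\<close> is the order topology, in which \<^term>\<open>\<infinity> :: enat\<close> is not isolated.\<close>

definition fun_space :: "(int \<Rightarrow> enat) topology" where
  "fun_space = product_topology (\<lambda>_. discrete_topology UNIV) UNIV"

definition periodic :: "(int \<Rightarrow> enat) \<Rightarrow> bool" where
  "periodic f \<longleftrightarrow> (\<exists>p>0. \<forall>m. f (m + p) = f m)"

definition trunc :: "nat \<Rightarrow> (int \<Rightarrow> enat) \<Rightarrow> int \<Rightarrow> enat" where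
  "trunc n f = (\<lambda>m. min (enat n) (f m))"

definition almost_periodic :: "(int \<Rightarrow> enat) \<Rightarrow> bool" where
  "almost_periodic f \<longleftrightarrow> \<not> periodic f \<and> (\<forall>n. periodic (trunc n f))"

definition AP :: "(int \<Rightarrow> enat) set" where
  "AP = {f. almost_periodic f}"

definition EZ :: "((int \<Rightarrow> enat) \<times> (int \<Rightarrow> enat)) set" where
  "EZ = {(f, g). \<exists>n. \<forall>m. f m = g (m + n)}"

definition Efin :: "((int \<Rightarrow> enat) \<times> (int \<Rightarrow> enat)) set" where
  "Efin = {(f, g). \<forall>l. (trunc l f, trunc l g) \<in> EZ}"

end

theory Submission
  imports Defs
begin

text \<open>
  A sequence \<open>x \<in> 2\<^sup>\<omega>\<close> is read as the 3-adic integer \<open>\<alpha> = (\<Sum>n. x\<^sub>n 3\<^sup>n)\<close> and sent to the function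
  \<open>m \<mapsto> v\<^sub>3(m - \<alpha>)\<close>. Its truncation at \<open>l\<close> depends only on \<open>m\<close> and \<open>\<alpha>\<close> modulo \<open>3\<^sup>l\<close>; so it is periodic
  and all sequences give translates of the same function. A translation of the whole function by
  \<open>n\<close> moves \<open>\<alpha>\<close> to \<open>\<alpha> + n\<close>, so two images are \<open>E\<^sub>\<int>\<close>-equivalent iff the difference of the 3-adic
  integers lies in \<open>\<int>\<close>. As this difference has digits in \<open>{-1, 0, 1}\<close>, this happens iff almost all
  of its digits vanish.
\<close>

section \<open>3-adic valuations by means of partial sums\<close>

definition digit_sum :: "(nat \<Rightarrow> bool) \<Rightarrow> nat \<Rightarrow> int" where
  "digit_sum x N = (\<Sum>n<N. of_bool (x n) * 3 ^ n)"

text \<open>Only residues of \<alpha> enter, so no 3-adic integers have to be constructed. The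
  supremum is infinite when \<open>m\<close> equals \<alpha>, which can happen only for eventually
  false \<open>x\<close>.\<close>

definition triadic_val :: "(nat \<Rightarrow> bool) \<Rightarrow> int \<Rightarrow> enat" where
  "triadic_val x m = (SUP N \<in> {N. 3 ^ N dvd m - digit_sum x N}. enat N)"

lemma digit_sum_Suc: "digit_sum x (Suc N) = digit_sum x N + of_bool (x N) * 3 ^ N"
  by (simp add: digit_sum_def)

lemma dvd_digit_sum_diff:
  assumes "N \<le> M"
  shows "3 ^ N dvd digit_sum x M - digit_sum x N"
  using assms
proof (induction M rule: dec_induct)
  case (step M)
  have "3 ^ N dvd (digit_sum x M - digit_sum x N) + of_bool (x M) * 3 ^ M"
    using step by (intro dvd_add dvd_mult le_imp_power_dvd) auto
  then show ?case
    by (simp add: digit_sum_Suc algebra_simps)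
qed simp

text \<open>Digits of index \<open>N\<close> and above contribute multiples of \<open>3 ^ N\<close>.
  Hence conditions from different levels can be compared at a common higher one.\<close>

lemma dvd_diff_digit_sum_iff:
  assumes "N \<le> M"
  shows "3 ^ N dvd m - digit_sum x M \<longleftrightarrow> 3 ^ N dvd m - digit_sum x N"
proof -
  have "m - digit_sum x N = (m - digit_sum x M) + (digit_sum x M - digit_sum x N)"
    by simp
  then show ?thesis
    using dvd_add_left_iff[OF dvd_digit_sum_diff[OF assms]] by metis
qed

text \<open>The set under the supremum is downward closed, by the preceding lemma.\<close>

lemma enat_le_triadic_val_iff: "enat N \<le> triadic_val x m \<longleftrightarrow> 3 ^ N dvd m - digit_sum x N"
proof
  assume le: "enat N \<le> triadic_val x m"
  show "3 ^ N dvd m - digit_sum x N"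
  proof (cases N)
    case (Suc K)
    \<comment> \<open>A strict bound below a supremum yields a member \<open>M > K\<close>, that is,
      \<open>M \<ge> N\<close>; hence the passage to the predecessor.\<close>
    then have "enat K < triadic_val x m"
      using le by (metis Suc_ile_eq)
    then obtain M where "3 ^ M dvd m - digit_sum x M" "K < M"
      by (auto simp: triadic_val_def less_SUP_iff)
    then show ?thesis
      using Suc dvd_diff_digit_sum_iff[of N M m x] by (meson Suc_leI dvd_trans le_imp_power_dvd)
  qed simp
next
  assume "3 ^ N dvd m - digit_sum x N"
  then show "enat N \<le> triadic_val x m"
    unfolding triadic_val_def by (intro SUP_upper) simp
qed

lemma enat_eq_iff_bounds: "a = b \<longleftrightarrow> (\<forall>N. enat N \<le> a \<longleftrightarrow> enat N \<le> b)"
proof -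
  have "a \<le> b" if "\<forall>N. enat N \<le> a \<longrightarrow> enat N \<le> b" for a b
  proof (cases b)
    case (enat k)
    then have "\<not> enat (Suc k) \<le> a"
      using that by (metis enat_ord_simps(1) Suc_n_not_le_n)
    then show ?thesis
      using enat Suc_ile_eq by fastforce
  qed simp
  then show ?thesis
    by (metis order_antisym)
qed

section \<open>Translations and differences of 3-adic integers\<close>

text \<open>By hypothesis, \<open>n\<close> is congruent modulo \<open>3 ^ l\<close> to the 3-adic
  integer of \<open>y\<close> minus that of \<open>x\<close>, and truncation at \<open>l\<close>
  sees only these residues. The case \<open>x = y\<close>, \<open>n = 3 ^ l\<close> yields
  periods.\<close>

lemma trunc_triadic_val_shift:
  assumes "3 ^ l dvd (n - digit_sum y l) + digit_sum x l"
  shows "trunc l (triadic_val x) m = trunc l (triadic_val y) (m + n)"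
proof -
  have "enat N \<le> triadic_val x m \<longleftrightarrow> enat N \<le> triadic_val y (m + n)" if "N \<le> l" for N
  proof -
    have "3 ^ N dvd (n - digit_sum y l) + digit_sum x l"
      using assms that by (meson dvd_trans le_imp_power_dvd)
    moreover have "m + n - digit_sum y l
        = ((n - digit_sum y l) + digit_sum x l) + (m - digit_sum x l)"
      by simp
    ultimately have "3 ^ N dvd m + n - digit_sum y l \<longleftrightarrow> 3 ^ N dvd m - digit_sum x l"
      by (simp only: dvd_add_right_iff)
    then show ?thesis
      by (simp only: enat_le_triadic_val_iff dvd_diff_digit_sum_iff[OF that])
  qed
  then have "enat N \<le> trunc l (triadic_val x) m \<longleftrightarrow> enat N \<le> trunc l (triadic_val y) (m + n)" for N
    by (auto simp: trunc_def)
  then show ?thesis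
    using enat_eq_iff_bounds by blast
qed

lemma triadic_val_Efin: "(triadic_val x, triadic_val y) \<in> Efin"
proof -
  have "(trunc l (triadic_val x), trunc l (triadic_val y)) \<in> EZ" for l
    unfolding EZ_def
    by (intro CollectI case_prodI exI[of _ "digit_sum y l - digit_sum x l"] allI
        trunc_triadic_val_shift) simp
  then show ?thesis
    by (simp add: Efin_def)
qed

lemma of_nat_less_three_power: "int n < 3 ^ n"
proof -
  have "n < 3 ^ n"
    by (rule power_gt_expt) simp
  then have "int n < int (3 ^ n)"
    by (simp only: of_nat_less_iff)
  then show ?thesis
    by simp
qed

lemma int_eq_0_if_powers_dvd:
  fixes p :: int
  assumes "\<And>N. 3 ^ N dvd p"
  shows "p = 0"
proof (rule ccontr)
  assume "p \<noteq> 0"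
  then have "3 ^ nat \<bar>p\<bar> \<le> \<bar>p\<bar>"
    using dvd_imp_le_int[OF _ assms] by simp
  moreover have "int (nat \<bar>p\<bar>) < 3 ^ nat \<bar>p\<bar>"
    by (rule of_nat_less_three_power)
  ultimately show False
    by simp
qed

text \<open>At \<open>m = digit_sum x N\<close> the left side is at least \<open>N\<close>, and the
  translation transfers this bound to \<open>y\<close>.\<close>

lemma triadic_val_shift_dvd:
  assumes "\<And>m. triadic_val x m = triadic_val y (m + n)"
  shows "3 ^ N dvd digit_sum x N + n - digit_sum y N"
  using assms[of "digit_sum x N"] enat_le_triadic_val_iff[of N]
  by (metis diff_self dvd_0_right)

lemma almost_periodic_triadic_val: "almost_periodic (triadic_val x)"
proof -
  have "p = 0" if "\<forall>m. triadic_val x (m + p) = triadic_val x m" for p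
  proof (rule int_eq_0_if_powers_dvd)
    \<comment> \<open>A period translates the function to itself, so the digit sums cancel.\<close>
    show "3 ^ N dvd p" for N
      using triadic_val_shift_dvd[of x x p N] that by simp
  qed
  then have "\<not> periodic (triadic_val x)"
    by (auto simp: periodic_def)
  moreover have "periodic (trunc l (triadic_val x))" for l
    using trunc_triadic_val_shift[of l "3 ^ l" x x] unfolding periodic_def
    by (intro exI[of _ "3 ^ l"]) simp
  ultimately show ?thesis
    by (simp add: almost_periodic_def)
qed

text \<open>With digits in \<open>{-1, 0, 1}\<close> the absolute value is at most
  \<open>(3 ^ N - 1) / 2\<close>. This is why the base is 3: in base 2 the all-true sequence
  represents -1, an integer, although it is not \<open>E0\<close>-related to the all-false
  one.\<close>

lemma digit_sum_diff_bound: "2 * \<bar>digit_sum x N - digit_sum y N\<bar> < 3 ^ N"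
proof (induction N)
  case (Suc N)
  then show ?case
    by (auto simp: digit_sum_Suc abs_if split: if_splits)
qed (simp add: digit_sum_def)

lemma triadic_val_EZ_iff: "(triadic_val x, triadic_val y) \<in> EZ \<longleftrightarrow> (x, y) \<in> E0"
proof
  assume "(triadic_val x, triadic_val y) \<in> EZ"
  then obtain n where n: "\<And>m. triadic_val x m = triadic_val y (m + n)"
    by (auto simp: EZ_def)
  \<comment> \<open>For such \<open>N\<close>, both \<open>\<bar>n\<bar>\<close> and the difference
    of digit sums are below half of \<open>3 ^ N\<close>, so a multiple of \<open>3 ^ N\<close>
    formed from them must vanish.\<close>
  have eq: "digit_sum y N - digit_sum x N = n" if "N \<ge> nat (2 * \<bar>n\<bar>)" for N
  proof (rule ccontr)
    assume "digit_sum y N - digit_sum x N \<noteq> n"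
    then have "digit_sum x N + n - digit_sum y N \<noteq> 0"
      by linarith
    then have "3 ^ N \<le> \<bar>digit_sum x N + n - digit_sum y N\<bar>"
      using dvd_imp_le_int[OF _ triadic_val_shift_dvd[OF n, of N]] by simp
    moreover have "2 * \<bar>n\<bar> < 3 ^ N"
      using that by (intro le_less_trans[OF _ of_nat_less_three_power]) simp
    ultimately show False
      using digit_sum_diff_bound[of x N y] by (smt (verit))
  qed
  \<comment> \<open>Equal differences at \<open>N\<close> and \<open>Suc N\<close> leave no room for
    distinct digits at \<open>N\<close>.\<close>
  have "x N = y N" if "N \<ge> nat (2 * \<bar>n\<bar>)" for N
    using eq[of N] eq[of "Suc N"] that by (auto simp: digit_sum_Suc of_bool_def split: if_splits)
  then show "(x, y) \<in> E0"
    unfolding E0_def by blast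
next
  assume "(x, y) \<in> E0"
  then obtain K where K: "\<And>n. n \<ge> K \<Longrightarrow> x n = y n"
    by (auto simp: E0_def)
  define n where "n = digit_sum y K - digit_sum x K"
  have eq: "digit_sum y N - digit_sum x N = n" if "N \<ge> K" for N
    using that by (induction N rule: dec_induct) (auto simp: n_def digit_sum_Suc K)
  have "enat N \<le> triadic_val x m \<longleftrightarrow> enat N \<le> triadic_val y (m + n)" for N m
  proof -
    \<comment> \<open>At level \<open>M\<close> the digit sums differ by exactly \<open>n\<close>,
      and \<open>M\<close> is high enough to test divisibility by \<open>3 ^ N\<close>.\<close>
    define M where "M = max N K"
    have "m + n - digit_sum y M = m - digit_sum x M"
      using eq[of M] by (simp add: M_def)
    then show ?thesis
      using dvd_diff_digit_sum_iff[of N M] unfolding enat_le_triadic_val_iff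
      by (metis M_def max.cobounded1)
  qed
  then have "triadic_val x m = triadic_val y (m + n)" for m
    using enat_eq_iff_bounds by blast
  then show "(triadic_val x, triadic_val y) \<in> EZ"
    unfolding EZ_def by blast
qed

section \<open>Borel measurability\<close>

lemma space_borel_of: "space (borel_of X) = topspace X"
  unfolding borel_of_def by (intro space_measure_of) (auto dest: openin_subset)

lemma borel_of_openin: "openin X U \<Longrightarrow> U \<in> sets (borel_of X)"
  unfolding borel_of_def by (subst sets_measure_of) (auto dest: openin_subset)

lemma topspace_cantor_space [simp]: "topspace cantor_space = UNIV"
  by (simp add: cantor_space_def)

lemma space_borel_cantor [simp]: "space (borel_of cantor_space) = UNIV"
  by (simp add: space_borel_of)

lemma cantor_coordinate_measurable [measurable]:
  "Measurable.pred (borel_of cantor_space) (\<lambda>x. x n)"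
proof -
  have "continuous_map cantor_space (discrete_topology UNIV) (\<lambda>x. x n)"
    unfolding cantor_space_def by (rule continuous_map_product_projection) simp
  then have "openin cantor_space {x. x n}"
    using openin_continuous_map_preimage[of cantor_space _ "\<lambda>x. x n" "{True}"] by simp
  then show ?thesis
    by (simp add: pred_def borel_of_openin)
qed

lemma digit_sum_measurable [measurable]:
  "Measurable.pred (borel_of cantor_space) (\<lambda>x. digit_sum x N = k)"
proof (induction N arbitrary: k)
  case (Suc N)
  have "digit_sum x (Suc N) = k \<longleftrightarrow>
      x N \<and> digit_sum x N = k - 3 ^ N \<or> \<not> x N \<and> digit_sum x N = k" for x
    by (auto simp: digit_sum_Suc)
  then show ?case
    using Suc by simp
qed (simp add: digit_sum_def)

lemma triadic_val_measurable [measurable]: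
  "Measurable.pred (borel_of cantor_space) (\<lambda>x. triadic_val x m = v)"
proof -
  \<comment> \<open>Quantifying over the value \<open>k\<close> of the digit sum reduces the
    condition to countably many measurable ones.\<close>
  have "triadic_val x m = v \<longleftrightarrow>
      (\<forall>N. (\<exists>k. 3 ^ N dvd m - k \<and> digit_sum x N = k) \<longleftrightarrow> enat N \<le> v)" for x
    by (subst enat_eq_iff_bounds) (simp add: enat_le_triadic_val_iff)
  then show ?thesis
    by (simp only:) measurable
qed

text \<open>Lists of constraints form a countable type, so there are only countably many
  cylinders.\<close>

definition cylinder :: "(int \<times> enat) list \<Rightarrow> (int \<Rightarrow> enat) set" where
  "cylinder l = {f. \<forall>(i, v) \<in> set l. f i = v}"

text \<open>A basic open set restricts finitely many coordinates; fixing there the values of one of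
  its points gives a cylinder inside it. As the union is countable, measurability need only be
  checked on cylinders.\<close>

lemma openin_fun_space_cylinders:
  assumes "openin fun_space U"
  shows "U = \<Union> (cylinder ` {l. cylinder l \<subseteq> U})"
proof
  show "U \<subseteq> \<Union> (cylinder ` {l. cylinder l \<subseteq> U})"
  proof
    fix f assume "f \<in> U"
    then obtain X where X: "finite {i. X i \<noteq> UNIV}" "f \<in> Pi\<^sub>E UNIV X" "Pi\<^sub>E UNIV X \<subseteq> U"
      using assms by (auto simp: fun_space_def openin_product_topology_alt)
    obtain I where I: "set I = {i. X i \<noteq> UNIV}"
      using X(1) finite_list by blast
    define l where "l = map (\<lambda>i. (i, f i)) I"
    have "cylinder l \<subseteq> Pi\<^sub>E UNIV X"
    proof
      fix g assume g: "g \<in> cylinder l"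
      have "g i \<in> X i" for i
      proof (cases "X i = UNIV")
        case False
        then have "g i = f i"
          using g I by (auto simp: cylinder_def l_def)
        then show ?thesis
          using X(2) by auto
      qed simp
      then show "g \<in> Pi\<^sub>E UNIV X"
        by auto
    qed
    moreover have "f \<in> cylinder l"
      by (auto simp: cylinder_def l_def)
    ultimately show "f \<in> \<Union> (cylinder ` {l. cylinder l \<subseteq> U})"
      using X(3) by blast
  qed
qed auto

lemma cylinder_vimage_measurable:
  "triadic_val -` cylinder l \<in> sets (borel_of cantor_space)"
proof -
  have "Measurable.pred (borel_of cantor_space) (\<lambda>x. \<forall>(i, v) \<in> set l. triadic_val x i = v)"
    by (induction l) auto
  then show ?thesis
    by (simp add: pred_def cylinder_def vimage_def)
qed

lemma triadic_val_borel:
  "triadic_val \<in> borel_of cantor_space \<rightarrow>\<^sub>M borel_of (subtopology fun_space AP)"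
  unfolding borel_of_def[of "subtopology fun_space AP"]
proof (rule measurable_measure_of)
  have top: "topspace (subtopology fun_space AP) = AP"
    by (simp add: fun_space_def)
  show "{U. openin (subtopology fun_space AP) U} \<subseteq> Pow (topspace (subtopology fun_space AP))"
    using openin_subset by blast
  show "triadic_val \<in> space (borel_of cantor_space) \<rightarrow> topspace (subtopology fun_space AP)"
    unfolding top by (simp add: AP_def almost_periodic_triadic_val)
  fix V assume "V \<in> {U. openin (subtopology fun_space AP) U}"
  then obtain U where U: "openin fun_space U" "V = U \<inter> AP"
    by (auto simp: openin_subtopology)
  have "triadic_val -` V = triadic_val -` U"
    by (auto simp: U(2) AP_def almost_periodic_triadic_val)
  also have "\<dots> = (\<Union>l \<in> {l. cylinder l \<subseteq> U}. triadic_val -` cylinder l)"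
    by (subst openin_fun_space_cylinders[OF U(1)]) (simp add: vimage_UN)
  also have "\<dots> \<in> sets (borel_of cantor_space)"
    by (intro sets.countable_UN'' cylinder_vimage_measurable) simp
  finally show "triadic_val -` V \<inter> space (borel_of cantor_space) \<in> sets (borel_of cantor_space)"
    by simp
qed

text \<open>Repeating each term of a sequence infinitely often embeds Cantor space in a transversal
  of \<open>E\<^sub>0\<close>.\<close>

definition repeat_terms :: "(nat \<Rightarrow> bool) \<Rightarrow> nat \<Rightarrow> bool" where
  "repeat_terms z = (\<lambda>n. z (fst (prod_decode n)))"

lemma repeat_terms_E0_iff: "(repeat_terms z, repeat_terms w) \<in> E0 \<longleftrightarrow> z = w"
proof
  assume "(repeat_terms z, repeat_terms w) \<in> E0"
  then obtain N where N: "\<And>n. n \<ge> N \<Longrightarrow> repeat_terms z n = repeat_terms w n"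
    by (auto simp: E0_def)
  \<comment> \<open>The position \<open>prod_encode (k, N)\<close> is at least \<open>N\<close> and
    carries the term of index \<open>k\<close>.\<close>
  have "z k = w k" for k
    using N[OF le_prod_encode_2[of N k]] by (simp add: repeat_terms_def)
  then show "z = w" ..
qed (simp add: E0_def)

lemma eqpoll_cantor_reals: "(UNIV :: (nat \<Rightarrow> bool) set) \<approx> (UNIV :: real set)"
proof -
  have "bij (Collect :: (nat \<Rightarrow> bool) \<Rightarrow> nat set)"
    by (rule bij_betw_byWitness[where f' = "\<lambda>S n. n \<in> S"]) auto
  then have "(UNIV :: (nat \<Rightarrow> bool) set) \<approx> (UNIV :: nat set set)"
    unfolding eqpoll_def by blast
  then show ?thesis
    using nat_sets_eqpoll_reals eqpoll_trans by blast
qed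

theorem theorem6p6:
  shows "(\<exists>\<phi>. borel_reduction cantor_space E0 (subtopology fun_space AP) (EZ \<inter> AP \<times> AP) \<phi> \<and>
              (\<exists>C \<in> UNIV // Efin. range \<phi> \<subseteq> C)) \<and>
         (\<exists>C \<in> UNIV // Efin. \<exists>A \<subseteq> C \<inter> AP.
              A \<approx> (UNIV :: real set) \<and> pairwise (\<lambda>f g. (f, g) \<notin> EZ) A)"
proof -
  \<comment> \<open>All values of \<open>triadic_val\<close> are \<open>Efin\<close>-related, so any
    sequence could represent the class.\<close>
  define C where "C = Efin `` {triadic_val (\<lambda>_. False)}"
  have C: "C \<in> UNIV // Efin" "range triadic_val \<subseteq> C"
    by (auto simp: C_def quotient_def triadic_val_Efin)
  have AP: "range triadic_val \<subseteq> AP"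
    by (auto simp: AP_def almost_periodic_triadic_val)
  have "borel_reduction cantor_space E0 (subtopology fun_space AP) (EZ \<inter> AP \<times> AP) triadic_val"
    using AP triadic_val_borel by (auto simp: borel_reduction_def triadic_val_EZ_iff)
  moreover
  define A where "A = range (triadic_val \<circ> repeat_terms)"
  have EZ_iff: "(triadic_val (repeat_terms z), triadic_val (repeat_terms w)) \<in> EZ \<longleftrightarrow> z = w" for z w
    by (simp add: triadic_val_EZ_iff repeat_terms_E0_iff)
  then have "inj (triadic_val \<circ> repeat_terms)"
    by (metis comp_apply injI)
  then have "A \<approx> (UNIV :: real set)"
    unfolding A_def using eqpoll_cantor_reals eqpoll_trans inj_on_image_eqpoll_self by blast
  moreover have "pairwise (\<lambda>f g. (f, g) \<notin> EZ) A"
    by (auto simp: A_def pairwise_def EZ_iff)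
  moreover have "A \<subseteq> C \<inter> AP"
    using C(2) AP by (auto simp: A_def)
  ultimately show ?thesis
    using C by blast
qed

end
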